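(* Let $X$ be a topological space and $AD(X)$ its Alexandroff duplicate. (1) If $AD(X)$ is almost Scheepers, then $X$ is also almost Scheepers. (2) If $AD(X)$ is weakly Scheepers, then $X$ is also weakly Scheepers.
   Context: The Alexandroff duplicate $AD(X)$ of a space $X$ is the set $X\times\{0,1\}$ topologized as follows: each point of $X\times\{1\}$ is isolated, and a basic neighbourhood of $(x,0)$ is a set of the form $(U\times\{0\})\cup\left((U\times\{1\})\setminus\{(x,1)\}\right)$, where $U$ is a neighbourhood of $x$ in $X$. A space $Z$ is almost Scheepers if for every sequence $(\mathcal{U}_n)_{n\in\mathbb{N}}$ of open covers of $Z$ there are finite $\mathcal{V}_n\subseteq\mathcal{U}_n$ such that every finite set $F\subseteq Z$ is contained in $\overline{\bigcup\mathcal{V}_n}$ for some $n$. $Z$ is weakly Scheepers if for every sequence $(\mathcal{U}_n)_{n\in\mathbb{N}}$ of open covers of $Z$ there are finite $\mathcal{V}_n\subseteq\mathcal{U}_n$ such that for every finite collection $\mathcal{F}$ of nonempty open subsets of $Z$ there is an $n$ with $U\cap\left(\bigcup\mathcal{V}_n\right)\neq\emptyset$ for all $U\in\mathcal{F}$. *)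

theory Defs
  imports "HOL-Analysis.Analysis"
begin

definition open_cover :: "'a topology \<Rightarrow> 'a set set \<Rightarrow> bool" where
  "open_cover Z \<U> \<longleftrightarrow> (\<forall>U\<in>\<U>. openin Z U) \<and> \<Union>\<U> = topspace Z"

definition almost_Scheepers :: "'a topology \<Rightarrow> bool" where
  "almost_Scheepers Z \<longleftrightarrow>
     (\<forall>\<U> :: nat \<Rightarrow> 'a set set. (\<forall>n. open_cover Z (\<U> n)) \<longrightarrow>
       (\<exists>\<V> :: nat \<Rightarrow> 'a set set. (\<forall>n. finite (\<V> n) \<and> \<V> n \<subseteq> \<U> n) \<and>
         (\<forall>F. finite F \<and> F \<subseteq> topspace Z \<longrightarrow> (\<exists>n. F \<subseteq> Z closure_of (\<Union>(\<V> n))))))"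

definition weakly_Scheepers :: "'a topology \<Rightarrow> bool" where
  "weakly_Scheepers Z \<longleftrightarrow>
     (\<forall>\<U> :: nat \<Rightarrow> 'a set set. (\<forall>n. open_cover Z (\<U> n)) \<longrightarrow>
       (\<exists>\<V> :: nat \<Rightarrow> 'a set set. (\<forall>n. finite (\<V> n) \<and> \<V> n \<subseteq> \<U> n) \<and>
         (\<forall>\<F>. finite \<F> \<and> (\<forall>U\<in>\<F>. openin Z U \<and> U \<noteq> {}) \<longrightarrow>
           (\<exists>n. \<forall>U\<in>\<F>. U \<inter> \<Union>(\<V> n) \<noteq> {}))))"

definition AD_basic_nbhd :: "'a \<Rightarrow> 'a set \<Rightarrow> ('a \<times> nat) set" where
  "AD_basic_nbhd x U = (U \<times> {0}) \<union> ((U \<times> {1}) - {(x, 1)})"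

text \<open>
  A set is open iff it contains a basic neighbourhood of each of its points. The points
  \<open>(x, 1)\<close> have \<open>{(x, 1)}\<close> as a basic neighbourhood and so impose no condition. It makes no
  difference whether \<open>U\<close> ranges over all neighbourhoods of \<open>x\<close> or only over the open ones.
  This is a topology for every \<open>X\<close>. The sets \<open>AD_basic_nbhd x U\<close> with \<open>U\<close> open are
  themselves open when \<open>X\<close> is $T_1$, but need not be otherwise.
\<close>

definition alexandroff_duplicate :: "'a topology \<Rightarrow> ('a \<times> nat) topology" where
  "alexandroff_duplicate X = topology (\<lambda>W. W \<subseteq> topspace X \<times> {0, 1} \<and>
     (\<forall>x. (x, 0) \<in> W \<longrightarrow> (\<exists>U. openin X U \<and> x \<in> U \<and> AD_basic_nbhd x U \<subseteq> W)))"

lemma openin_alexandroff_duplicate: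
  "openin (alexandroff_duplicate X) W \<longleftrightarrow> W \<subseteq> topspace X \<times> {0, 1} \<and>
     (\<forall>x. (x, 0) \<in> W \<longrightarrow> (\<exists>U. openin X U \<and> x \<in> U \<and> AD_basic_nbhd x U \<subseteq> W))"
proof -
  have "istopology (\<lambda>W. W \<subseteq> topspace X \<times> {0, 1} \<and>
     (\<forall>x. (x, 0) \<in> W \<longrightarrow> (\<exists>U. openin X U \<and> x \<in> U \<and> AD_basic_nbhd x U \<subseteq> W)))"
    (is "istopology ?P")
    unfolding istopology_def
  proof (intro conjI allI impI)
    fix S T assume S: "?P S" and T: "?P T"
    show "S \<inter> T \<subseteq> topspace X \<times> {0, 1}" using S by blast
    fix x assume x: "(x, 0) \<in> S \<inter> T"
    obtain U where U: "openin X U" "x \<in> U" "AD_basic_nbhd x U \<subseteq> S"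
      using S x by blast
    obtain V where V: "openin X V" "x \<in> V" "AD_basic_nbhd x V \<subseteq> T"
      using T x by blast
    have "AD_basic_nbhd x (U \<inter> V) \<subseteq> S \<inter> T"
      using U(3) V(3) unfolding AD_basic_nbhd_def by blast
    with U V show "\<exists>U. openin X U \<and> x \<in> U \<and> AD_basic_nbhd x U \<subseteq> S \<inter> T"
      by (intro exI[of _ "U \<inter> V"]) auto
  next
    fix \<K> assume K: "\<forall>K\<in>\<K>. ?P K"
    show "\<Union>\<K> \<subseteq> topspace X \<times> {0, 1}" using K by blast
    fix x assume "(x, 0) \<in> \<Union>\<K>"
    then obtain K where "K \<in> \<K>" "(x, 0) \<in> K" by blast
    with K show "\<exists>U. openin X U \<and> x \<in> U \<and> AD_basic_nbhd x U \<subseteq> \<Union>\<K>"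
      by (meson Union_upper subset_trans)
  qed
  then show ?thesis
    unfolding alexandroff_duplicate_def by (simp add: topology_inverse')
qed

lemma topspace_alexandroff_duplicate:
  "topspace (alexandroff_duplicate X) = topspace X \<times> {0, 1}"
proof -
  have "openin (alexandroff_duplicate X) (topspace X \<times> {0, 1})"
    unfolding openin_alexandroff_duplicate AD_basic_nbhd_def
    by (auto intro!: exI[of _ "topspace X"])
  then show ?thesis
    by (metis openin_alexandroff_duplicate openin_subset openin_topspace subset_antisym)
qed

lemma openin_alexandroff_duplicate_isolated:
  "x \<in> topspace X \<Longrightarrow> openin (alexandroff_duplicate X) {(x, 1)}"
  by (simp add: openin_alexandroff_duplicate)

lemma openin_AD_basic_nbhd:
  assumes "t1_space X" "openin X U"
  shows "openin (alexandroff_duplicate X) (AD_basic_nbhd x U)"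
  unfolding openin_alexandroff_duplicate
proof (intro conjI allI impI)
  show "AD_basic_nbhd x U \<subseteq> topspace X \<times> {0, 1}"
    using openin_subset[OF assms(2)] unfolding AD_basic_nbhd_def by auto
  fix y assume "(y, 0) \<in> AD_basic_nbhd x U"
  then have y: "y \<in> U" by (auto simp: AD_basic_nbhd_def)
  show "\<exists>V. openin X V \<and> y \<in> V \<and> AD_basic_nbhd y V \<subseteq> AD_basic_nbhd x U"
  proof (cases "y = x")
    case True
    then show ?thesis using y assms(2) by blast
  next
    case False
    have "openin X (U - {x})"
      using assms by (metis Diff_insert0 Diff_empty openin_diff closedin_t1_singleton
          openin_subset subsetD)
    moreover have "AD_basic_nbhd y (U - {x}) \<subseteq> AD_basic_nbhd x U"
      by (auto simp: AD_basic_nbhd_def)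
    ultimately show ?thesis using y False by blast
  qed
qed

end

(* Both properties pass to continuous images: pull the covers back along the map and push the
   finite selections forward. The projection of AD(X) onto X is a continuous surjection. *)
theory Submission
  imports Defs
begin

text \<open>Both properties pass from a space Z to any continuous image X of Z. Covers of X are
  pulled back along the surjection f, the property of Z selects finitely many preimages from each,
  and \<open>finite_vimage_selection\<close> returns to finitely many members of the original
  covers. The almost Scheepers case then uses that points lift along f and that f maps the closure
  of a set into the closure of its image; the weakly Scheepers case uses that nonempty open sets
  have nonempty open preimages. Finally, \<open>fst\<close> is a continuous surjection from the
  Alexandroff duplicate onto X.\<close>

lemma open_cover_vimage:
  assumes f: "continuous_map Z X f" and \<U>: "open_cover X \<U>"
  shows "open_cover Z ((\<lambda>U. {z \<in> topspace Z. f z \<in> U}) ` \<U>)"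
proof -
  \<comment> \<open>The preimage is cut down to \<open>topspace Z\<close> because \<open>f\<close>
    is a total function about which continuity says nothing outside that set.\<close>
  have "openin Z {z \<in> topspace Z. f z \<in> U}" if "U \<in> \<U>" for U
    using openin_continuous_map_preimage[OF f] \<U> that by (auto simp: open_cover_def)
  moreover have "f z \<in> \<Union>\<U>" if "z \<in> topspace Z" for z
    using \<U> that continuous_map_image_subset_topspace[OF f] by (auto simp: open_cover_def)
  ultimately show ?thesis
    by (auto simp: open_cover_def)
qed

text \<open>Different members of \<open>\<U> n\<close> may have the same preimage, so a choice is
  made: a finite subset of an image is the image of a finite subset. An inclusion between the unions
  is enough, since both Scheepers conditions survive enlarging the selected unions.\<close>

lemma finite_vimage_selection:
  assumes "\<forall>n. finite (\<W> n) \<and> \<W> n \<subseteq> (\<lambda>U. {z \<in> topspace Z. f z \<in> U}) ` \<U> n"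
  obtains \<V> where "\<forall>n. finite (\<V> n) \<and> \<V> n \<subseteq> \<U> n" "\<forall>n. f ` \<Union>(\<W> n) \<subseteq> \<Union>(\<V> n)"
proof -
  have "\<forall>n. \<exists>V. finite V \<and> V \<subseteq> \<U> n \<and> \<W> n = (\<lambda>U. {z \<in> topspace Z. f z \<in> U}) ` V"
  proof
    show "\<exists>V. finite V \<and> V \<subseteq> \<U> n \<and> \<W> n = (\<lambda>U. {z \<in> topspace Z. f z \<in> U}) ` V" for n
      using finite_subset_image[of "\<W> n" "\<lambda>U. {z \<in> topspace Z. f z \<in> U}" "\<U> n"]
        assms[rule_format, of n] by blast
  qed
  from choice[OF this] obtain \<V> where \<V>: "\<forall>n. finite (\<V> n) \<and> \<V> n \<subseteq> \<U> n \<and>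
      \<W> n = (\<lambda>U. {z \<in> topspace Z. f z \<in> U}) ` \<V> n"
    by (elim exE) (rule that)
  show thesis
  proof (rule that)
    show "\<forall>n. finite (\<V> n) \<and> \<V> n \<subseteq> \<U> n" using \<V> by (intro allI conjI; simp)
    have "f ` \<Union>(\<W> n) \<subseteq> \<Union>(\<V> n)" for n using \<V>[rule_format, of n] by auto
    then show "\<forall>n. f ` \<Union>(\<W> n) \<subseteq> \<Union>(\<V> n)" ..
  qed
qed

lemma almost_Scheepers_continuous_image:
  assumes Z: "almost_Scheepers Z"
    and f: "continuous_map Z X f" and surj: "f ` topspace Z = topspace X"
  shows "almost_Scheepers X"
  unfolding almost_Scheepers_def
proof (intro allI impI)
  fix \<U> :: "nat \<Rightarrow> 'b set set" assume "\<forall>n. open_cover X (\<U> n)"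
  then have "\<forall>n. open_cover Z ((\<lambda>U. {z \<in> topspace Z. f z \<in> U}) ` \<U> n)"
    using open_cover_vimage[OF f] by blast
  note ex = Z[unfolded almost_Scheepers_def, THEN spec, THEN mp, OF this]
  obtain \<W> where fin: "\<forall>n. finite (\<W> n) \<and> \<W> n \<subseteq> (\<lambda>U. {z \<in> topspace Z. f z \<in> U}) ` \<U> n"
    and \<W>: "\<forall>F. finite F \<and> F \<subseteq> topspace Z \<longrightarrow> (\<exists>n. F \<subseteq> Z closure_of \<Union>(\<W> n))"
    using ex by (elim exE conjE) (rule that)
  obtain \<V>
    where \<V>: "\<forall>n. finite (\<V> n) \<and> \<V> n \<subseteq> \<U> n" and sub: "\<forall>n. f ` \<Union>(\<W> n) \<subseteq> \<Union>(\<V> n)"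
    by (rule finite_vimage_selection[OF fin]) (rule that)
  have "\<exists>n. F \<subseteq> X closure_of \<Union>(\<V> n)" if "finite F" "F \<subseteq> topspace X" for F
  proof -
    \<comment> \<open>Surjectivity lets one preimage be picked for each point of \<open>F\<close>,
      so \<open>E\<close> stays finite and is a legitimate test set for \<open>Z\<close>.\<close>
    obtain E where E: "finite E" "E \<subseteq> topspace Z" "F = f ` E"
      using \<open>finite F\<close> \<open>F \<subseteq> topspace X\<close> surj by (metis finite_subset_image)
    obtain n where "E \<subseteq> Z closure_of \<Union>(\<W> n)"
      using \<W>[rule_format, OF conjI, OF E(1,2)] by (elim exE)
    then have "F \<subseteq> f ` (Z closure_of \<Union>(\<W> n))"
      unfolding E(3) by (rule image_mono)
    also have "\<dots> \<subseteq> X closure_of (f ` \<Union>(\<W> n))"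
      by (rule continuous_map_image_closure_subset[OF f])
    also have "\<dots> \<subseteq> X closure_of \<Union>(\<V> n)"
      using sub by (intro closure_of_mono) (rule spec)
    finally show ?thesis ..
  qed
  with \<V> show "\<exists>\<V>. (\<forall>n. finite (\<V> n) \<and> \<V> n \<subseteq> \<U> n) \<and>
      (\<forall>F. finite F \<and> F \<subseteq> topspace X \<longrightarrow> (\<exists>n. F \<subseteq> X closure_of \<Union>(\<V> n)))"
    by (intro exI[of _ \<V>]) simp
qed

lemma weakly_Scheepers_continuous_image:
  assumes Z: "weakly_Scheepers Z"
    and f: "continuous_map Z X f" and surj: "f ` topspace Z = topspace X"
  shows "weakly_Scheepers X"
  unfolding weakly_Scheepers_def
proof (intro allI impI)
  fix \<U> :: "nat \<Rightarrow> 'b set set" assume "\<forall>n. open_cover X (\<U> n)"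
  then have "\<forall>n. open_cover Z ((\<lambda>U. {z \<in> topspace Z. f z \<in> U}) ` \<U> n)"
    using open_cover_vimage[OF f] by blast
  note ex = Z[unfolded weakly_Scheepers_def, THEN spec, THEN mp, OF this]
  obtain \<W> where fin: "\<forall>n. finite (\<W> n) \<and> \<W> n \<subseteq> (\<lambda>U. {z \<in> topspace Z. f z \<in> U}) ` \<U> n"
    and \<W>: "\<forall>\<F>. finite \<F> \<and> (\<forall>U\<in>\<F>. openin Z U \<and> U \<noteq> {}) \<longrightarrow>
      (\<exists>n. \<forall>U\<in>\<F>. U \<inter> \<Union>(\<W> n) \<noteq> {})"
    using ex by (elim exE conjE) (rule that)
  obtain \<V>
    where \<V>: "\<forall>n. finite (\<V> n) \<and> \<V> n \<subseteq> \<U> n" and sub: "\<forall>n. f ` \<Union>(\<W> n) \<subseteq> \<Union>(\<V> n)"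
    by (rule finite_vimage_selection[OF fin]) (rule that)
  have "\<exists>n. \<forall>U\<in>\<F>. U \<inter> \<Union>(\<V> n) \<noteq> {}"
    if "finite \<F>" and \<F>: "\<forall>U\<in>\<F>. openin X U \<and> U \<noteq> {}" for \<F>
  proof -
    have "openin Z {z \<in> topspace Z. f z \<in> U} \<and> {z \<in> topspace Z. f z \<in> U} \<noteq> {}"
      if "U \<in> \<F>" for U
    proof
      show "openin Z {z \<in> topspace Z. f z \<in> U}"
        using \<F> that openin_continuous_map_preimage[OF f] by blast
      have "U \<noteq> {}" "U \<subseteq> f ` topspace Z"
        using \<F> that openin_subset surj by auto
      then show "{z \<in> topspace Z. f z \<in> U} \<noteq> {}"
        by blast
    qed
    \<comment> \<open>The preimages of the members of \<open>\<F>\<close> form the finite test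
      family in \<open>Z\<close>, which yields one index \<open>n\<close> for all of them. Any point
      witnessing an intersection there is then pushed forward by \<open>f\<close>.\<close>
    then obtain n where n: "\<forall>U\<in>\<F>. {z \<in> topspace Z. f z \<in> U} \<inter> \<Union>(\<W> n) \<noteq> {}"
      using \<W>[rule_format, of "(\<lambda>U. {z \<in> topspace Z. f z \<in> U}) ` \<F>"] \<open>finite \<F>\<close> by auto
    have "U \<inter> \<Union>(\<V> n) \<noteq> {}" if "U \<in> \<F>" for U
    proof -
      have "{z \<in> topspace Z. f z \<in> U} \<inter> \<Union>(\<W> n) \<noteq> {}"
        using n that by (rule bspec)
      then obtain z where "f z \<in> U" "z \<in> \<Union>(\<W> n)"
        by blast
      then show ?thesis
        using subsetD[OF sub[rule_format] imageI] by blast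
    qed
    then show ?thesis by blast
  qed
  with \<V> show "\<exists>\<V>. (\<forall>n. finite (\<V> n) \<and> \<V> n \<subseteq> \<U> n) \<and>
      (\<forall>\<F>. finite \<F> \<and> (\<forall>U\<in>\<F>. openin X U \<and> U \<noteq> {}) \<longrightarrow>
        (\<exists>n. \<forall>U\<in>\<F>. U \<inter> \<Union>(\<V> n) \<noteq> {}))"
    by (intro exI[of _ \<V>]) simp
qed

text \<open>The preimage of an open \<open>U\<close> is \<open>U \<times> {0, 1}\<close>, which
  contains \<open>AD_basic_nbhd x U\<close> for every \<open>x\<close> in \<open>U\<close>; hence
  \<open>U\<close> itself witnesses openness at each point \<open>(x, 0)\<close>.\<close>

lemma continuous_map_alexandroff_duplicate_fst:
  "continuous_map (alexandroff_duplicate X) X fst"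
  unfolding continuous_map_def
proof (intro conjI allI impI)
  show "fst \<in> topspace (alexandroff_duplicate X) \<rightarrow> topspace X"
    by (auto simp: topspace_alexandroff_duplicate)
  fix U assume U: "openin X U"
  have "{z \<in> topspace (alexandroff_duplicate X). fst z \<in> U} = U \<times> {0, 1}"
    using openin_subset[OF U] by (auto simp: topspace_alexandroff_duplicate)
  moreover have "openin (alexandroff_duplicate X) (U \<times> {0, 1})"
    using U openin_subset[OF U]
    by (auto simp: openin_alexandroff_duplicate AD_basic_nbhd_def intro!: exI[of _ U])
  ultimately show "openin (alexandroff_duplicate X)
      {z \<in> topspace (alexandroff_duplicate X). fst z \<in> U}"
    by simp
qed

theorem theorem4p2:
  fixes X :: "'a topology"
  shows "(almost_Scheepers (alexandroff_duplicate X) \<longrightarrow> almost_Scheepers X) \<and>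
         (weakly_Scheepers (alexandroff_duplicate X) \<longrightarrow> weakly_Scheepers X)"
proof -
  have "fst ` topspace (alexandroff_duplicate X) = topspace X"
    by (simp add: topspace_alexandroff_duplicate)
  then show ?thesis
    using continuous_map_alexandroff_duplicate_fst almost_Scheepers_continuous_image
      weakly_Scheepers_continuous_image by blast
qed

end
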